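(* The sequence $(c_n)_{n\ge 0}$ satisfies, for all $n\ge 0$, $$\sum_{0\le k\le n}\frac{c_k}{n+1+k}=\frac{c_0}{n+1}+\ldots+\frac{c_n}{2n+1}=\delta_{n0},$$ where $\delta_{n0}=1$ if $n=0$ and $\delta_{n0}=0$ otherwise.
   Context: Let $\mathcal H=L^2([0,1],dx)$ (complex-valued functions, Lebesgue measure) with its norm $\|\cdot\|$. The sequence $(c_n)_{n\ge 0}$ is defined recursively: $c_0=1$, and, writing $p_n(x)=c_0+c_1x+\ldots+c_nx^n$, for each $n\ge 0$ the number $c_{n+1}$ is the unique complex number $c$ for which the norm $\|p_n(x)+c\,x^{n+1}\|$ is minimal among all $c\in\mathbb C$. (That is, $c_1,c_2,\ldots$ are the coefficients of the orthorecursive expansion of the function $1$ with respect to the system $x,x^2,x^3,\ldots$.) *)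

theory Defs
  imports "HOL-Analysis.Analysis"
begin

text \<open>
  The norm is taken on representatives and is the \<open>L\<^sup>2\<close> norm for square integrable \<open>f\<close>;
  it is only applied to polynomial functions below.
\<close>

definition L2_norm :: "'a measure \<Rightarrow> ('a \<Rightarrow> complex) \<Rightarrow> real" where
  "L2_norm M f = sqrt (LINT x|M. (cmod (f x))\<^sup>2)"

text \<open>
  That the minimiser described by \<open>THE\<close> exists and is unique is not built in.
\<close>

fun orthorec_coeff :: "nat \<Rightarrow> complex" where
  "orthorec_coeff 0 = 1"
| "orthorec_coeff (Suc n) =
     (THE c. is_arg_min
        (\<lambda>z. L2_norm (lebesgue_on {0..1})
           (\<lambda>x::real. (\<Sum>k\<le>n. orthorec_coeff k * of_real x ^ k) + z * of_real x ^ Suc n))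
        (\<lambda>_. True) c)"

end

theory Submission
  imports Defs
begin

text \<open>
  Completing the square: if \<open>f\<close> is orthogonal to \<open>g\<close>, then
  \<open>\<parallel>f + w g\<parallel>\<^sup>2 = \<parallel>f\<parallel>\<^sup>2 + \<bar>w\<bar>\<^sup>2 \<parallel>g\<parallel>\<^sup>2\<close>. So the coefficient that makes \<open>p\<^sub>n + c x\<^sup>n\<^sup>+\<^sup>1\<close> orthogonal
  to \<open>x\<^sup>n\<^sup>+\<^sup>1\<close> is the unique minimiser, and the orthogonality relation is the claimed identity,
  because the inner product of \<open>x\<^sup>k\<close> and \<open>x\<^sup>n\<close> is \<open>1 / (n + k + 1)\<close>.
\<close>

lemma L2_norm_add_orthogonal_less:
  assumes f: "integrable M (\<lambda>x. (cmod (f x))\<^sup>2)"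
    and g: "integrable M (\<lambda>x. (cmod (g x))\<^sup>2)"
    and fg: "integrable M (\<lambda>x. f x * cnj (g x))"
    and orth: "(LINT x|M. f x * cnj (g x)) = 0"
    and pos: "0 < (LINT x|M. (cmod (g x))\<^sup>2)"
    and "w \<noteq> 0"
  shows "L2_norm M f < L2_norm M (\<lambda>x. f x + w * g x)"
proof -
  \<comment> \<open>Half the cross term of the squared modulus; orthogonality makes its integral
    vanish for every \<open>w\<close>.\<close>
  define h where "h x = Re (cnj w * (f x * cnj (g x)))" for x
  have sq: "(cmod (f x + w * g x))\<^sup>2 = (cmod (f x))\<^sup>2 + (2 * h x + (cmod w)\<^sup>2 * (cmod (g x))\<^sup>2)" for x
    unfolding cmod_power2 h_def by (simp add: power2_eq_square algebra_simps)
  have cross: "integrable M (\<lambda>x. cnj w * (f x * cnj (g x)))"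
    using fg by (rule integrable_mult_right)
  have h: "integrable M h"
    unfolding h_def using cross by (rule integrable_Re)
  have "(LINT x|M. h x) = Re (LINT x|M. cnj w * (f x * cnj (g x)))"
    unfolding h_def using cross by (rule integral_Re)
  also have "\<dots> = 0"
    using orth by simp
  finally have "(LINT x|M. (cmod (f x + w * g x))\<^sup>2) =
      (LINT x|M. (cmod (f x))\<^sup>2) + (cmod w)\<^sup>2 * (LINT x|M. (cmod (g x))\<^sup>2)"
    unfolding sq using f g h by simp
  then show ?thesis
    using pos \<open>w \<noteq> 0\<close> by (simp add: L2_norm_def)
qed

text \<open>Source of all inner products below: monomials are real on the interval, so a product of
  two is again a power.\<close>

lemma has_bochner_integral_power_01:
  "has_bochner_integral (lebesgue_on {0..1}) (\<lambda>x. (of_real x :: complex) ^ m) (1 / of_nat (m + 1))"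
proof -
  have "((\<lambda>x::real. x ^ m) has_integral (1 ^ Suc m / real (Suc m) - 0 ^ Suc m / real (Suc m))) {0..1}"
    by (rule fundamental_theorem_of_calculus)
      (auto simp: has_real_derivative_iff_has_vector_derivative[symmetric]
         intro!: derivative_eq_intros simp del: of_nat_Suc power_Suc)
  moreover have "integrable (lebesgue_on {0..1}) (\<lambda>x::real. x ^ m)"
    by (intro continuous_imp_integrable_real continuous_intros)
  ultimately have "has_bochner_integral (lebesgue_on {0..1}) (\<lambda>x::real. x ^ m) (1 / real (m + 1))"
    by (simp add: has_bochner_integral_iff lebesgue_integral_eq_integral integral_unique)
  then show ?thesis
    using has_bochner_integral_bounded_linear[OF bounded_linear_of_real, of _ "\<lambda>x. x ^ m" _]
    by (fastforce simp: has_bochner_integral_iff)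
qed

theorem proposition1:
  fixes n :: nat
  shows "(\<Sum>k\<le>n. orthorec_coeff k / of_nat (n + 1 + k)) = (if n = 0 then 1 else 0)"
proof (cases n)
  case 0
  then show ?thesis by simp
next
  case (Suc m)
  let ?M = "lebesgue_on {0..1}"
  let ?g = "\<lambda>x::real. of_real x ^ n :: complex"
  define p where "p x = (\<Sum>k\<le>m. orthorec_coeff k * of_real x ^ k)" for x :: real
  define B where "B = (\<Sum>k\<le>m. orthorec_coeff k / of_nat (n + 1 + k))"
  \<comment> \<open>Solves \<open>B + c / (2n + 1) = 0\<close>: \<open>B\<close> is the inner
    product of \<open>p\<close> with \<open>?g\<close>, and \<open>1 / (2n + 1)\<close> is the
    squared norm of \<open>?g\<close>.\<close>
  define c where "c = - of_nat (n + 1 + n) * B"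
  define f where "f x = p x + c * ?g x" for x
  define N where "N z = L2_norm ?M (\<lambda>x. p x + z * ?g x)" for z
  have cont: "continuous_on {0..1} f"
    unfolding f_def p_def by (intro continuous_intros)
  have inner: "has_bochner_integral ?M (\<lambda>x. a * of_real x ^ k * ?g x) (a / of_nat (n + 1 + k))"
    for a :: complex and k
    using has_bochner_integral_mult_right[OF has_bochner_integral_power_01[of "k + n"], of a]
    by (simp add: power_add mult_ac add_ac)
  have c: "c / of_nat (n + 1 + n) = - B"
    by (simp add: c_def del: of_nat_add of_nat_Suc)
  have "has_bochner_integral ?M (\<lambda>x. f x * ?g x) (B + c / of_nat (n + 1 + n))"
    unfolding f_def p_def B_def distrib_right sum_distrib_right
    by (intro has_bochner_integral_add has_bochner_integral_sum inner)
  \<comment> \<open>The conjugate is harmless, as \<open>?g\<close> takes real values.\<close>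
  then have orth: "has_bochner_integral ?M (\<lambda>x. f x * cnj (?g x)) 0"
    unfolding c by simp
  have "has_bochner_integral ?M (\<lambda>x. Re (?g x * ?g x)) (1 / real (n + 1 + n))"
    using has_bochner_integral_bounded_linear[OF bounded_linear_Re inner[of 1 n]]
    by simp
  then have g: "has_bochner_integral ?M (\<lambda>x. (cmod (?g x))\<^sup>2) (1 / real (n + 1 + n))"
    by (simp add: norm_power power2_eq_square flip: of_real_power of_real_mult power_mult_distrib)
  have "integrable ?M (\<lambda>x. (cmod (f x))\<^sup>2)"
    by (intro continuous_imp_integrable_real continuous_intros cont)
  \<comment> \<open>\<open>p + z * ?g\<close> equals \<open>f + (z - c) * ?g\<close>. Strictness for
    every such \<open>z\<close> yields both existence and uniqueness of the minimiser, as
    \<open>THE\<close> requires.\<close>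
  then have "N c < N z" if "z \<noteq> c" for z
    using L2_norm_add_orthogonal_less[of ?M f ?g "z - c"] orth g that
    by (simp add: has_bochner_integral_iff N_def f_def[abs_def] algebra_simps)
  then have "is_arg_min N (\<lambda>_. True) z \<longleftrightarrow> z = c" for z
    unfolding is_arg_min_def using less_asym by blast
  then have "(THE z. is_arg_min N (\<lambda>_. True) z) = c"
    by simp
  then have "orthorec_coeff n = c"
    unfolding N_def p_def Suc orthorec_coeff.simps .
  \<comment> \<open>The term \<open>k = n\<close> of the sum is \<open>- B\<close>, which cancels
    the terms with \<open>k \<le> m\<close>.\<close>
  then show ?thesis
    using Suc c by (simp add: B_def)
qed

end
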